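(* Let $K\ge1$, let $\alpha_1,\dots,\alpha_K\in\mathbb C$ be distinct, and let $\Phi_n,\bar\Phi_n,\Phi^*_n,\Xi_n,\Xi^*_n$, with leading coefficient $\widehat\kappa_n$ and $\widehat r_n=\Phi_n(0)/\widehat\kappa_n$, $\widehat{\bar r}_n=\bar\Phi_n(0)/\widehat\kappa_n$, be the bi-orthogonal system of the weight $\widehat w(z)=\prod_{j=1}^K(z-\alpha_j)\,w(z)$. For a sequence $a=(a_m)$ write $v(a,z)=(a_n(z),a_{n+1}(z),\dots,a_{n+K}(z))$ and $u(a,z)=(a_n(z),\dots,a_{n+K-1}(z))$; $\det(v_0;v_1;\dots;v_N)$ denotes the determinant with rows $v_0,\dots,v_N$. Then for all $n\ge0$ $$\prod_{j=1}^K(z-\alpha_j)\,\Phi_n(z)=(-1)^K\frac{\widehat\kappa_n}{\kappa_{n+K}}\,\frac{\det(v(\phi,z);v(\phi,\alpha_1);\dots;v(\phi,\alpha_K))}{\det(u(\phi,\alpha_1);\dots;u(\phi,\alpha_K))},$$ $$\prod_{j=1}^K(z-\alpha_j)\,\Phi^*_n(z)=(-1)^K\frac{\bar\Phi_n(0)}{\bar\phi_{n+K}(0)}\,\frac{\det(v(\phi^*,z);v(\phi^*,\alpha_1);\dots;v(\phi^*,\alpha_K))}{\det(u(\phi^*,\alpha_1);\dots;u(\phi^*,\alpha_K))},$$ $$\Xi_n(z)=(-1)^K\frac{\widehat\kappa_n}{\kappa_{n+K}}\,\frac{\det(v(\xi,z);v(\phi,\alpha_1);\dots;v(\phi,\alpha_K))}{\det(u(\phi,\alpha_1);\dots;u(\phi,\alpha_K))},$$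 $$\Xi^*_n(z)=(-1)^K\frac{\bar\Phi_n(0)}{\bar\phi_{n+K}(0)}\,\frac{\det(v(\xi^*,z);v(\phi^*,\alpha_1);\dots;v(\phi^*,\alpha_K))}{\det(u(\phi^*,\alpha_1);\dots;u(\phi^*,\alpha_K))}.$$ If moreover all $\alpha_i\neq0$, the leading and $r$-coefficients are given by $$\prod_{i=1}^K\alpha_i\;\widehat\kappa_n^2=(-1)^K\frac{\det\big((\kappa_n,\dots,\kappa_{n+K});v(\phi^*,\alpha_1);\dots;v(\phi^*,\alpha_K)\big)}{\det\big((1/\kappa_n,\dots,1/\kappa_{n+K});v(\phi^*,\alpha_1);\dots;v(\phi^*,\alpha_K)\big)},$$ $$\widehat r_n=\frac{1}{\kappa_{n+K}\prod_{i=1}^K\alpha_i}\,\frac{\det(v(\phi,0);v(\phi,\alpha_1);\dots;v(\phi,\alpha_K))}{\det(u(\phi,\alpha_1);\dots;u(\phi,\alpha_K))},$$ $$\widehat{\bar r}_n=\bar\phi_{n+K}(0)\prod_{i=1}^K\alpha_i\,\frac{\det(u(\phi^*,\alpha_1);\dots;u(\phi^*,\alpha_K))}{\det\big((\kappa_n,\dots,\kappa_{n+K});v(\phi^*,\alpha_1);\dots;v(\phi^*,\alpha_K)\big)}.$$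
   Context: $\mathbb T$ is the unit circle. For a complex-valued weight $w$ on $\mathbb T$ put $w_k=\int_{\mathbb T}\frac{d\zeta}{2\pi i\zeta}w(\zeta)\zeta^{-k}$ and $I_n[w]=\det[w_{j-k}]_{j,k=0,\dots,n-1}$, $I_0=1$. If $I_n[w]\ne0$ for all $n\ge0$, the bi-orthogonal system of $w$ is: polynomials $\phi_n,\bar\phi_n$ of degree $n$ with the same leading coefficient $\kappa_n$ satisfying $\int_{\mathbb T}\frac{d\zeta}{2\pi i\zeta}w(\zeta)\phi_m(\zeta)\bar\phi_n(\bar\zeta)=\delta_{m,n}$ with $\bar\zeta=1/\zeta$ ($\bar\phi_n$ is a separate polynomial, not in general the complex conjugate of $\phi_n$; $\kappa_n^2=I_n/I_{n+1}$, with a choice of square root $\kappa_n$ fixed); the reciprocal polynomial $\phi^*_n(z)=z^n\bar\phi_n(1/z)$; and the associated functions, for $z\notin\mathbb T$ and $n>0$, $\xi_n(z)=\int_{\mathbb T}\frac{d\zeta}{2\pi i\zeta}\frac{\zeta+z}{\zeta-z}w(\zeta)\phi_n(\zeta)$, $\ \xi^*_n(z)=-z^n\int_{\mathbb T}\frac{d\zeta}{2\pi i\zeta}\frac{\zeta+z}{\zeta-z}w(\zeta)\bar\phi_n(\bar\zeta)=\frac1{\kappa_n}-\int_{\mathbb T}\frac{d\zeta}{2\pi i\zeta}\frac{\zeta+z}{\zeta-z}w(\zeta)\phi^*_n(\zeta)$, and $\xi_0(z)=\kappa_0[w_0+F(z)]$, $\xi^*_0(z)=\kappa_0[w_0-F(z)]$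 with $F(z)=\int_{\mathbb T}\frac{d\zeta}{2\pi i\zeta}\frac{\zeta+z}{\zeta-z}w(\zeta)$. Set $r_n=\phi_n(0)/\kappa_n$, $\bar r_n=\bar\phi_n(0)/\kappa_n$. The same definitions and normalisation applied to a modified weight $\widehat w$ give $\Phi_n,\bar\Phi_n,\Phi^*_n,\Xi_n,\Xi^*_n$, leading coefficient $\widehat\kappa_n$, and $\widehat r_n,\widehat{\bar r}_n$. Standing generic assumptions: both the original and the modified bi-orthogonal systems exist, and $r_n\bar r_n\ne0,1$, $\widehat r_n\widehat{\bar r}_n\ne0,1$ for all $n\ge1$. *)

theory Defs
  imports "HOL-Complex_Analysis.Complex_Analysis" "Jordan_Normal_Form.Determinant"
begin

(* HOL-Analysis also has constants det, mat and vec. Below, Matrix and Determinant refer to the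
   matrices, vectors and determinants of Jordan_Normal_Form, whose sizes are natural numbers;
   in particular the determinant of the 0 x 0 matrix is 1. *)

(* A weight is a function on the plane of which only the values on the unit circle are used. *)
definition weight_on_circle :: "(complex \<Rightarrow> complex) \<Rightarrow> bool" where
  "weight_on_circle w \<longleftrightarrow> (\<lambda>t. w (circlepath 0 1 t)) absolutely_integrable_on {0..1}"

definition circle_integral :: "(complex \<Rightarrow> complex) \<Rightarrow> complex" where
  "circle_integral f =
     contour_integral (circlepath 0 1) (\<lambda>\<zeta>. f \<zeta> / (2 * complex_of_real pi * \<i> * \<zeta>))"

definition fourier_coeff :: "(complex \<Rightarrow> complex) \<Rightarrow> int \<Rightarrow> complex" where
  "fourier_coeff w k = circle_integral (\<lambda>\<zeta>. w \<zeta> * \<zeta> powi (- k))"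

definition toeplitz_det :: "(complex \<Rightarrow> complex) \<Rightarrow> nat \<Rightarrow> complex" where
  "toeplitz_det w n =
     Determinant.det (Matrix.mat n n (\<lambda>(j, k). fourier_coeff w (int j - int k)))"

(* On the circle the conjugate of the integration variable is its inverse. The sequence \<phi>b is
   independent of \<phi>, not its complex conjugate. The relation \<kappa> n ^ 2 = I n / I (Suc n) is a consequence
   of orthonormality, so fixing \<kappa> amounts to choosing the square roots. *)
definition biorthogonal_system ::
    "(complex \<Rightarrow> complex) \<Rightarrow> (nat \<Rightarrow> complex) \<Rightarrow> (nat \<Rightarrow> complex poly) \<Rightarrow> (nat \<Rightarrow> complex poly) \<Rightarrow> bool"
  where
  "biorthogonal_system w \<kappa> \<phi> \<phi>b \<longleftrightarrow>
     (\<forall>n. toeplitz_det w n \<noteq> 0) \<and>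
     (\<forall>n. degree (\<phi> n) = n \<and> degree (\<phi>b n) = n \<and>
          lead_coeff (\<phi> n) = \<kappa> n \<and> lead_coeff (\<phi>b n) = \<kappa> n) \<and>
     (\<forall>m n. circle_integral (\<lambda>\<zeta>. w \<zeta> * poly (\<phi> m) \<zeta> * poly (\<phi>b n) (1 / \<zeta>)) =
            (if m = n then 1 else 0))"

definition r_coeff :: "(nat \<Rightarrow> complex) \<Rightarrow> (nat \<Rightarrow> complex poly) \<Rightarrow> nat \<Rightarrow> complex" where
  "r_coeff \<kappa> p n = poly (p n) 0 / \<kappa> n"

definition generic_system ::
    "(nat \<Rightarrow> complex) \<Rightarrow> (nat \<Rightarrow> complex poly) \<Rightarrow> (nat \<Rightarrow> complex poly) \<Rightarrow> bool" where
  "generic_system \<kappa> \<phi> \<phi>b \<longleftrightarrow>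
     (\<forall>n\<ge>1. r_coeff \<kappa> \<phi> n * r_coeff \<kappa> \<phi>b n \<noteq> 0 \<and> r_coeff \<kappa> \<phi> n * r_coeff \<kappa> \<phi>b n \<noteq> 1)"

(* z^n p(1/z) for deg p = n. The polynomial is used, so that its value at z = 0 is the leading
   coefficient of p; the pointwise formula would go wrong there because 1 / 0 = 0. *)
definition reciprocal :: "(nat \<Rightarrow> complex poly) \<Rightarrow> nat \<Rightarrow> complex poly" where
  "reciprocal p n = reflect_poly (p n)"

definition carath :: "(complex \<Rightarrow> complex) \<Rightarrow> complex \<Rightarrow> complex" where
  "carath w z = circle_integral (\<lambda>\<zeta>. (\<zeta> + z) / (\<zeta> - z) * w \<zeta>)"

(* The associated functions are meaningful only for z off the unit circle. *)
definition assoc_fun ::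
    "(complex \<Rightarrow> complex) \<Rightarrow> (nat \<Rightarrow> complex) \<Rightarrow> (nat \<Rightarrow> complex poly) \<Rightarrow> nat \<Rightarrow> complex \<Rightarrow> complex" where
  "assoc_fun w \<kappa> \<phi> n z =
     (if n = 0 then \<kappa> 0 * (fourier_coeff w 0 + carath w z)
      else circle_integral (\<lambda>\<zeta>. (\<zeta> + z) / (\<zeta> - z) * w \<zeta> * poly (\<phi> n) \<zeta>))"

definition assoc_fun_star ::
    "(complex \<Rightarrow> complex) \<Rightarrow> (nat \<Rightarrow> complex) \<Rightarrow> (nat \<Rightarrow> complex poly) \<Rightarrow> nat \<Rightarrow> complex \<Rightarrow> complex" where
  "assoc_fun_star w \<kappa> \<phi>b n z =
     (if n = 0 then \<kappa> 0 * (fourier_coeff w 0 - carath w z)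
      else - (z ^ n) * circle_integral (\<lambda>\<zeta>. (\<zeta> + z) / (\<zeta> - z) * w \<zeta> * poly (\<phi>b n) (1 / \<zeta>)))"

definition modified_weight ::
    "nat \<Rightarrow> (nat \<Rightarrow> complex) \<Rightarrow> (complex \<Rightarrow> complex) \<Rightarrow> complex \<Rightarrow> complex" where
  "modified_weight K \<alpha> w z = (\<Prod>j=1..K. z - \<alpha> j) * w z"

definition det_rows :: "complex Matrix.vec list \<Rightarrow> complex" where
  "det_rows rs = Determinant.det (mat_of_rows (length rs) rs)"

definition segment :: "nat \<Rightarrow> nat \<Rightarrow> (nat \<Rightarrow> complex) \<Rightarrow> complex Matrix.vec" where
  "segment n N a = Matrix.vec N (\<lambda>j. a (n + j))"

(* The rows v(a,z) (entries n, ..., n+K) and u(a,z) (entries n, ..., n+K-1). *)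
definition v_row :: "nat \<Rightarrow> nat \<Rightarrow> (nat \<Rightarrow> complex \<Rightarrow> complex) \<Rightarrow> complex \<Rightarrow> complex Matrix.vec" where
  "v_row n K a z = segment n (K + 1) (\<lambda>m. a m z)"

definition u_row :: "nat \<Rightarrow> nat \<Rightarrow> (nat \<Rightarrow> complex \<Rightarrow> complex) \<Rightarrow> complex \<Rightarrow> complex Matrix.vec" where
  "u_row n K a z = segment n K (\<lambda>m. a m z)"

(* det (x; v(a,\<alpha> 1); ...; v(a,\<alpha> K)) for a row x of length K + 1 *)
definition det_v ::
    "nat \<Rightarrow> nat \<Rightarrow> (nat \<Rightarrow> complex) \<Rightarrow> complex Matrix.vec \<Rightarrow> (nat \<Rightarrow> complex \<Rightarrow> complex) \<Rightarrow> complex" where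
  "det_v n K \<alpha> x a = det_rows (x # map (\<lambda>j. v_row n K a (\<alpha> j)) [1..<K + 1])"

(* det (u(a,\<alpha> 1); ...; u(a,\<alpha> K)) *)
definition det_u ::
    "nat \<Rightarrow> nat \<Rightarrow> (nat \<Rightarrow> complex) \<Rightarrow> (nat \<Rightarrow> complex \<Rightarrow> complex) \<Rightarrow> complex" where
  "det_u n K \<alpha> a = det_rows (map (\<lambda>j. u_row n K a (\<alpha> j)) [1..<K + 1])"

abbreviation polys :: "(nat \<Rightarrow> complex poly) \<Rightarrow> nat \<Rightarrow> complex \<Rightarrow> complex" where
  "polys p \<equiv> (\<lambda>m. poly (p m))"

end

theory Submission
  imports Defs
begin

text \<open>
  Let P be the polynomial with simple zeros \<open>\<alpha>\<^sub>1, \<dots>, \<alpha>\<^sub>K\<close>. The form \<open>\<langle>f, g\<rangle> = \<integral> w f(\<zeta>) g(1/\<zeta>)\<close> of the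
  modified weight is \<open>\<langle>P f, g\<rangle>\<close>, so \<open>P \<Phi>\<^sub>n\<close> is orthogonal to all polynomials of degree below n and
  is therefore a combination \<open>\<Sum> c\<^sub>m \<phi>\<^sub>m\<close> with \<open>n \<le> m \<le> n + K\<close>. The leading coefficient and the K zeros
  of P determine the \<open>c\<^sub>m\<close> up to a combination of \<open>\<phi>\<^sub>n, \<dots>, \<phi>\<^sub>n\<^sub>+\<^sub>K\<^sub>-\<^sub>1\<close> that is divisible by P;
  the quotient has degree below n and is orthogonal to too many polynomials for the modified weight,
  so it vanishes. Hence the \<open>c\<^sub>m\<close> are multiples of the cofactors of the first row of the determinant, and
  applying to \<open>P \<Phi>\<^sub>n = \<Sum> c\<^sub>m \<phi>\<^sub>m\<close> different linear functionals (evaluation, Cauchy-type integrals)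
  gives the different formulas. The argument for \<open>\<phi>\<^sup>*\<^sub>n\<close> is the same with orthogonality to
  \<open>\<zeta>, \<dots>, \<zeta>\<^sup>n\<close> in place of \<open>1, \<dots>, \<zeta>\<^sup>n\<^sup>-\<^sup>1\<close>; here \<open>\<phi>\<^sup>*\<^sub>m\<close> has degree exactly m because
  \<open>\<phi>b\<^sub>m(0) \<noteq> 0\<close>. The formulas for the coefficients come from the values at 0 and from
  \<open>\<integral> w \<phi>\<^sup>*\<^sub>m = 1 / \<kappa>\<^sub>m\<close>.
\<close>

section \<open>Polynomial families graded by degree, and linear factors\<close>

lemma degree_graded_expansion:
  fixes p :: "nat \<Rightarrow> 'a::field poly"
  assumes deg: "\<And>m. degree (p m) = m" and nz: "\<And>m. p m \<noteq> 0" and "degree f \<le> N"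
  shows "\<exists>c. f = (\<Sum>m\<le>N. Polynomial.smult (c m) (p m))"
  using \<open>degree f \<le> N\<close>
proof (induction N arbitrary: f)
  case 0
  then obtain a where f: "f = [:a:]" by (metis degree_eq_zeroE le_zero_eq)
  obtain b where b: "p 0 = [:b:]" using deg by (metis degree_eq_zeroE)
  then have "b \<noteq> 0" using nz[of 0] by auto
  then show ?case by (intro exI[of _ "\<lambda>_. a / b"]) (simp add: f b)
next
  case (Suc N)
  define a where "a = coeff f (Suc N) / coeff (p (Suc N)) (Suc N)"
  have lc: "coeff (p (Suc N)) (Suc N) \<noteq> 0"
    using deg[of "Suc N"] nz[of "Suc N"] by (metis leading_coeff_0_iff)
  define g where "g = f - Polynomial.smult a (p (Suc N))"
  have "coeff g i = 0" if "i > N" for i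
    using that lc Suc.prems deg[of "Suc N"]
    by (cases "i = Suc N") (auto simp: g_def a_def coeff_eq_0)
  then have "degree g \<le> N" by (simp add: degree_le)
  from Suc.IH[OF this] obtain c where c: "g = (\<Sum>m\<le>N. Polynomial.smult (c m) (p m))" by blast
  have "f = g + Polynomial.smult a (p (Suc N))" by (simp add: g_def)
  also have "\<dots> = (\<Sum>m\<le>Suc N. Polynomial.smult ((c(Suc N := a)) m) (p m))"
    by (simp add: c)
  finally show ?case by blast
qed

lemma degree_graded_independent:
  fixes p :: "nat \<Rightarrow> 'a::field poly"
  assumes deg: "\<And>m. degree (p m) = m" and nz: "\<And>m. p m \<noteq> 0"
    and "(\<Sum>m=n..<N. Polynomial.smult (c m) (p m)) = 0" and "m \<in> {n..<N}"
  shows "c m = 0"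
  using assms(3,4)
proof (induction N)
  case (Suc N)
  have n: "n \<le> N" using Suc.prems(2) by simp
  have lc: "coeff (p N) N \<noteq> 0"
    using deg[of N] nz[of N] by (metis leading_coeff_0_iff)
  have "0 = coeff (\<Sum>m=n..<Suc N. Polynomial.smult (c m) (p m)) N"
    using Suc.prems(1) by simp
  also have "\<dots> = (\<Sum>m=n..<N. c m * coeff (p m) N) + c N * coeff (p N) N"
    using n by (simp add: coeff_sum)
  also have "(\<Sum>m=n..<N. c m * coeff (p m) N) = 0"
    by (rule sum.neutral) (auto simp: coeff_eq_0 deg)
  finally have "c N = 0" using lc by simp
  then show ?case using Suc n by (cases "m = N") auto
qed auto

lemma prod_linear_factors_dvd:
  fixes \<alpha> :: "'b \<Rightarrow> 'a::field"
  assumes "finite I" "inj_on \<alpha> I" "\<And>i. i \<in> I \<Longrightarrow> poly f (\<alpha> i) = 0"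
  shows "(\<Prod>i\<in>I. [:- \<alpha> i, 1:]) dvd f"
  using assms
proof (induction I rule: finite_induct)
  case (insert i I)
  from insert obtain g where g: "f = (\<Prod>i\<in>I. [:- \<alpha> i, 1:]) * g" by auto
  have "poly (\<Prod>i\<in>I. [:- \<alpha> i, 1:]) (\<alpha> i) \<noteq> 0"
    using insert by (auto simp: poly_prod)
  with insert(5)[of i] have "poly g (\<alpha> i) = 0" by (simp add: g)
  then have "[:- \<alpha> i, 1:] dvd g" by (simp add: poly_eq_0_iff_dvd)
  then have "[:- \<alpha> i, 1:] * (\<Prod>i\<in>I. [:- \<alpha> i, 1:]) dvd g * (\<Prod>i\<in>I. [:- \<alpha> i, 1:])"
    by (rule mult_dvd_mono) simp
  then show ?case using insert(1,2) by (simp add: g mult.commute)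
qed auto

lemma degree_prod_linear_factors:
  fixes \<alpha> :: "'b \<Rightarrow> 'a::field"
  shows "degree (\<Prod>i\<in>I. [:- \<alpha> i, 1:]) = card I" "lead_coeff (\<Prod>i\<in>I. [:- \<alpha> i, 1:]) = 1"
proof -
  show "degree (\<Prod>i\<in>I. [:- \<alpha> i, 1:]) = card I"
    by (simp add: degree_prod_eq_sum_degree)
  show "lead_coeff (\<Prod>i\<in>I. [:- \<alpha> i, 1:]) = 1"
    by (induction I rule: infinite_finite_induct)
      (simp_all add: lead_coeff_mult del: mult_pCons_left)
qed

section \<open>Determinants with a free first row and rows of values at the nodes\<close>

text \<open>Laplace expansion along the first row. The cofactors \<open>C\<close> are the same for
  all \<open>x\<close>, so the determinant is one fixed linear functional of its first row; deleting
  the last column leaves the rows of \<open>det_u\<close>, which gives \<open>C K\<close>.\<close>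

lemma det_v_first_row:
  "\<exists>C. C K = (-1) ^ K * det_u n K \<alpha> a \<and>
       (\<forall>x. det_v n K \<alpha> (segment n (K + 1) x) a = (\<Sum>j\<le>K. C j * x (n + j)))"
proof -
  define V where "V x = mat_of_rows (Suc K) (segment n (K + 1) x # map (\<lambda>j. v_row n K a (\<alpha> j)) [1..<K + 1])" for x
  define D where "D j = mat_delete (V (\<lambda>_. 0)) 0 j" for j
  have V: "V x \<in> carrier_mat (Suc K) (Suc K)" for x
    by (simp add: V_def mat_of_rows_def del: upt_Suc)
  have dV: "det_v n K \<alpha> (segment n (K + 1) x) a = Determinant.det (V x)" for x
    by (simp add: det_v_def det_rows_def V_def del: upt_Suc)
  have V0: "V x $$ (0, j) = x (n + j)" if "j \<le> K" for x j
    using that by (simp add: V_def mat_of_rows_def segment_def del: upt_Suc)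
  have del: "mat_delete (V x) 0 j = D j" if "j \<le> K" for x j
    unfolding D_def using that
    by (intro eq_matI) (auto simp: mat_delete_def V_def mat_of_rows_def del: upt_Suc)
  define L where "L = [1..<K + 1]"
  have L: "length L = K" "\<And>i. i < K \<Longrightarrow> L ! i = Suc i"
    by (auto simp: L_def simp del: upt_Suc)
  have DK: "D K = mat_of_rows K (map (\<lambda>j. u_row n K a (\<alpha> j)) [1..<K + 1])"
    unfolding D_def V_def L_def[symmetric]
    by (intro eq_matI) (auto simp: L mat_delete_def mat_of_rows_def v_row_def u_row_def segment_def del: upt_Suc)
  have "det_v n K \<alpha> (segment n (K + 1) x) a = (\<Sum>j\<le>K. (-1) ^ j * Determinant.det (D j) * x (n + j))" for x
    unfolding dV laplace_expansion_row[OF V zero_less_Suc] lessThan_Suc_atMost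
    by (rule sum.cong) (auto simp: cofactor_def del V0)
  moreover have "(-1) ^ K * Determinant.det (D K) = (-1) ^ K * det_u n K \<alpha> a"
    by (simp add: DK det_u_def det_rows_def del: upt_Suc)
  ultimately show ?thesis
    by (intro exI[of _ "\<lambda>j. (-1) ^ j * Determinant.det (D j)"]) simp
qed

lemma det_v_repeated_row:
  assumes "i \<in> {1..K}"
  shows "det_v n K \<alpha> (v_row n K a (\<alpha> i)) a = 0"
proof -
  let ?A = "mat_of_rows (Suc K) (v_row n K a (\<alpha> i) # map (\<lambda>j. v_row n K a (\<alpha> j)) [1..<K + 1])"
  have "Determinant.det ?A = 0"
  proof (rule det_identical_rows[of _ "Suc K" 0 i])
    show "?A \<in> carrier_mat (Suc K) (Suc K)" by (simp add: mat_of_rows_def del: upt_Suc)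
    show "Matrix.row ?A 0 = Matrix.row ?A i"
      using assms by (intro eq_vecI) (auto simp: mat_of_rows_def nth_Cons' simp del: upt_Suc)
  qed (use assms in auto)
  then show ?thesis by (simp add: det_v_def det_rows_def del: upt_Suc)
qed

text \<open>A kernel vector of the singular matrix supplies the coefficients. Excluding such a
  combination is how \<open>det_u\<close> is shown to be non-zero.\<close>

lemma det_u_eq_0E:
  assumes "det_u n K \<alpha> a = 0"
  obtains e where "\<exists>m\<in>{n..<n + K}. e m \<noteq> 0"
    "\<And>i. i \<in> {1..K} \<Longrightarrow> (\<Sum>m=n..<n + K. e m * a m (\<alpha> i)) = 0"
proof -
  define U where "U = mat_of_rows K (map (\<lambda>j. u_row n K a (\<alpha> j)) [1..<K + 1])"
  have U: "U \<in> carrier_mat K K" by (simp add: U_def mat_of_rows_def del: upt_Suc)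
  have "Determinant.det U = 0" using assms by (simp add: det_u_def det_rows_def U_def del: upt_Suc)
  then obtain v where v: "v \<in> carrier_vec K" "v \<noteq> 0\<^sub>v K" "U *\<^sub>v v = 0\<^sub>v K"
    using det_0_iff_vec_prod_zero_field[OF U] by blast
  have "\<exists>j<K. vec_index v j \<noteq> 0"
    using v(1,2) by (metis carrier_vecD eq_vecI index_zero_vec(1,2))
  then obtain j where j: "j < K" "vec_index v j \<noteq> 0" by blast
  show thesis
  proof
    show "\<exists>m\<in>{n..<n + K}. vec_index v (m - n) \<noteq> 0"
      using j by (intro bexI[of _ "n + j"]) auto
    fix i assume i: "i \<in> {1..K}"
    have "0 = vec_index (U *\<^sub>v v) (i - 1)" using i v by auto
    also have "\<dots> = (\<Sum>j=0..<K. a (n + j) (\<alpha> i) * vec_index v j)"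
      using i v(1) by (auto simp: U_def mat_of_rows_def scalar_prod_def u_row_def segment_def simp del: upt_Suc)
    also have "\<dots> = (\<Sum>m=n..<n + K. vec_index v (m - n) * a m (\<alpha> i))"
      by (rule sum.reindex_bij_witness[of _ "\<lambda>m. m - n" "\<lambda>j. n + j"]) auto
    finally show "(\<Sum>m=n..<n + K. vec_index v (m - n) * a m (\<alpha> i)) = 0" by simp
  qed
qed

section \<open>The node polynomial and the quotient of determinants\<close>

definition node_poly :: "nat \<Rightarrow> (nat \<Rightarrow> complex) \<Rightarrow> complex poly" where
  "node_poly K \<alpha> = (\<Prod>j=1..K. [:- \<alpha> j, 1:])"

lemma poly_node_poly: "poly (node_poly K \<alpha>) z = (\<Prod>j=1..K. z - \<alpha> j)"
  by (simp add: node_poly_def poly_prod)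

lemma degree_node_poly: "degree (node_poly K \<alpha>) = K"
  by (simp add: node_poly_def degree_prod_linear_factors(1))

(* The coefficients c with m < n + K are determined by c (n + K) because the a m with m < n + K
   are linearly independent on the zeros \<alpha> i; hence they are proportional to the cofactors of the
   first row, and the relation between c and the cofactors can be paired with any sequence x. *)
lemma linear_form_eq_det_ratio:
  fixes a :: "nat \<Rightarrow> complex poly" and A :: "complex poly"
  assumes inj: "inj_on \<alpha> {1..K}"
    and deg: "\<And>m. degree (a m) = m" and nz: "\<And>m. a m \<noteq> 0"
    and A: "degree A = n"
    and c: "node_poly K \<alpha> * A = (\<Sum>m=n..n + K. Polynomial.smult (c m) (a m))"
    and indep: "\<forall>Q e. degree Q < n \<longrightarrow>
      node_poly K \<alpha> * Q = (\<Sum>m=n..<n + K. Polynomial.smult (e m) (a m)) \<longrightarrow> Q = 0"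
  shows "det_u n K \<alpha> (polys a) \<noteq> 0"
    and "(\<Sum>m=n..n + K. c m * x m) = (-1) ^ K * (lead_coeff A / lead_coeff (a (n + K))) *
           (det_v n K \<alpha> (segment n (K + 1) x) (polys a) / det_u n K \<alpha> (polys a))"
proof -
  have P: "degree (node_poly K \<alpha>) = K" "lead_coeff (node_poly K \<alpha>) = 1" "node_poly K \<alpha> \<noteq> 0"
    using degree_prod_linear_factors[where I = "{1..K}" and \<alpha> = \<alpha>]  by (auto simp: node_poly_def)
  \<comment> \<open>A combination that vanishes at all nodes is divisible by the node polynomial;
    its degree is below n + K, so the quotient falls under \<open>indep\<close> and is 0.\<close>
  have vanish: "e m = 0" if e: "\<And>i. i \<in> {1..K} \<Longrightarrow> (\<Sum>m=n..<n + K. e m * poly (a m) (\<alpha> i)) = 0"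
    and m: "m \<in> {n..<n + K}" for e m
  proof -
    define F where "F = (\<Sum>m=n..<n + K. Polynomial.smult (e m) (a m))"
    have "poly F (\<alpha> i) = 0" if "i \<in> {1..K}" for i
      using e[OF that] by (simp add: F_def poly_sum)
    then have "node_poly K \<alpha> dvd F"
      unfolding node_poly_def using inj by (intro prod_linear_factors_dvd) auto
    then obtain Q where Q: "F = node_poly K \<alpha> * Q" by blast
    have "Q = 0"
    proof (rule ccontr)
      assume "Q \<noteq> 0"
      have "degree F < n + K"
        unfolding F_def using m deg
        by (intro degree_sum_less) (auto intro: le_less_trans[OF degree_smult_le])
      then have "degree Q < n"
        using P \<open>Q \<noteq> 0\<close> by (simp add: Q degree_mult_eq)
      then show False using indep Q \<open>Q \<noteq> 0\<close> unfolding F_def by metis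
    qed
    then have "F = 0" by (simp add: Q)
    then show "e m = 0"
      using degree_graded_independent[where p = a and n = n and N = "n + K" and c = e and m = m] deg nz m by (simp add: F_def)
  qed
  show du: "det_u n K \<alpha> (polys a) \<noteq> 0"
  proof
    assume "det_u n K \<alpha> (polys a) = 0"
    then obtain e where "\<exists>m\<in>{n..<n + K}. e m \<noteq> 0"
      "\<And>i. i \<in> {1..K} \<Longrightarrow> (\<Sum>m=n..<n + K. e m * poly (a m) (\<alpha> i)) = 0"
      by (rule det_u_eq_0E) blast
    with vanish show False by blast
  qed
  obtain C where CK: "C K = (-1) ^ K * det_u n K \<alpha> (polys a)"
    and C: "\<And>x. det_v n K \<alpha> (segment n (K + 1) x) (polys a) = (\<Sum>j\<le>K. C j * x (n + j))"
    using det_v_first_row[where n = n and K = K and \<alpha> = \<alpha> and a = "polys a"] by blast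
  have C': "det_v n K \<alpha> (segment n (K + 1) x) (polys a) = (\<Sum>m=n..n + K. C (m - n) * x m)" for x
    unfolding C by (rule sum.reindex_bij_witness[of _ "\<lambda>m. m - n" "\<lambda>j. n + j"]) auto
  \<comment> \<open>The factor is chosen so that \<open>t * C K\<close> equals
    \<open>c (n + K)\<close>: the latter is the quotient of the leading coefficients, the node
    polynomial being monic, and the sign cancels the one in \<open>CK\<close>.\<close>
  define t where "t = (-1) ^ K * (lead_coeff A / lead_coeff (a (n + K))) / det_u n K \<alpha> (polys a)"
  define e where "e m = c m - t * C (m - n)" for m
  have split: "{n..n + K} = insert (n + K) {n..<n + K}" by auto
  have lc: "coeff (a (n + K)) (n + K) \<noteq> 0"
    using deg[of "n + K"] nz[of "n + K"] by (metis leading_coeff_0_iff)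
  have "lead_coeff A = coeff (node_poly K \<alpha> * A) (n + K)"
    using coeff_mult_degree_sum[of "node_poly K \<alpha>" A] P A by (simp add: add.commute)
  also have "\<dots> = c (n + K) * coeff (a (n + K)) (n + K) + (\<Sum>m=n..<n + K. c m * coeff (a m) (n + K))"
    unfolding c split by (simp add: coeff_sum)
  also have "(\<Sum>m=n..<n + K. c m * coeff (a m) (n + K)) = 0"
    by (rule sum.neutral) (auto simp: coeff_eq_0 deg)
  finally have "e (n + K) = 0"
    using lc du by (simp add: e_def t_def CK deg field_simps power_mult_distrib[symmetric])
  \<comment> \<open>With the top term gone, \<open>vanish\<close> applies to \<open>e\<close>: at a
    node the combination with \<open>c\<close> is 0 because the node polynomial is, the one with the
    cofactors because the determinant has a repeated row.\<close>
  moreover have "e m = 0" if m: "m \<in> {n..<n + K}" for m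
  proof (rule vanish[OF _ m])
    fix i assume i: "i \<in> {1..K}"
    then have "poly (node_poly K \<alpha>) (\<alpha> i) = 0" by (auto simp: poly_node_poly)
    then have "(\<Sum>m=n..n + K. c m * poly (a m) (\<alpha> i)) = 0"
      using arg_cong[OF c, of "\<lambda>p. poly p (\<alpha> i)"] by (simp add: poly_sum)
    moreover have "(\<Sum>m=n..n + K. C (m - n) * poly (a m) (\<alpha> i)) = 0"
      using det_v_repeated_row[OF i, where n = n and a = "polys a" and \<alpha> = \<alpha>] by (simp add: v_row_def flip: C')
    ultimately have "(\<Sum>m=n..n + K. e m * poly (a m) (\<alpha> i)) = 0"
      by (simp add: e_def ring_distribs sum_subtractf mult.assoc flip: sum_distrib_left)
    then show "(\<Sum>m=n..<n + K. e m * poly (a m) (\<alpha> i)) = 0"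
      using \<open>e (n + K) = 0\<close> by (simp add: split)
  qed
  ultimately have "c m = t * C (m - n)" if "m \<in> {n..n + K}" for m
    using that by (auto simp: e_def split)
  then have "(\<Sum>m=n..n + K. c m * x m) = t * det_v n K \<alpha> (segment n (K + 1) x) (polys a)"
    unfolding C' sum_distrib_left by (simp add: mult.assoc)
  then show "(\<Sum>m=n..n + K. c m * x m) = (-1) ^ K * (lead_coeff A / lead_coeff (a (n + K))) *
           (det_v n K \<alpha> (segment n (K + 1) x) (polys a) / det_u n K \<alpha> (polys a))"
    by (simp add: t_def)
qed

section \<open>Biorthogonal expansions for a bilinear form\<close>

text \<open>No integral enters here, so the same expansions serve both weights and, through
  \<open>swap\<close>, both families.\<close>

locale biorthogonal_pair =
  fixes B :: "'a::field poly \<Rightarrow> 'a poly \<Rightarrow> 'a" and p q :: "nat \<Rightarrow> 'a poly"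
  assumes add_left: "B (f + g) h = B f h + B g h"
    and smult_left: "B (Polynomial.smult c f) h = c * B f h"
    and add_right: "B h (f + g) = B h f + B h g"
    and smult_right: "B h (Polynomial.smult c f) = c * B h f"
    and degree_left: "degree (p m) = m" and degree_right: "degree (q m) = m"
    and left_nonzero: "p m \<noteq> 0" and right_nonzero: "q m \<noteq> 0"
    and biorthonormal: "B (p m) (q n) = (if m = n then 1 else 0)"
begin

lemma zero_left: "B 0 h = 0"
  using smult_left[of 0 0 h] by simp

lemma sum_left: "B (\<Sum>i\<in>I. Polynomial.smult (c i) (f i)) h = (\<Sum>i\<in>I. c i * B (f i) h)"
  by (induction I rule: infinite_finite_induct) (simp_all add: zero_left add_left smult_left)

lemma orthogonal_expansion:
  assumes "degree f \<le> N"
  shows "f = (\<Sum>m\<le>N. Polynomial.smult (B f (q m)) (p m))"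
proof -
  obtain c where c: "f = (\<Sum>m\<le>N. Polynomial.smult (c m) (p m))"
    using degree_graded_expansion[of p f N] degree_left left_nonzero assms by blast
  have "B f (q m) = c m" if "m \<le> N" for m
    using that unfolding c sum_left by (simp add: biorthonormal if_distrib cong: if_cong)
  with c show ?thesis by simp
qed

text \<open>Used in two ways: for n \<le> N it confines the expansion to a band, and for N < n the
  sum is empty and \<open>f\<close> is 0.\<close>

lemma orthogonal_span:
  assumes "degree f \<le> N" "\<And>m. m < n \<Longrightarrow> B f (q m) = 0"
  shows "f = (\<Sum>m=n..N. Polynomial.smult (B f (q m)) (p m))"
proof -
  have "(\<Sum>m\<le>N. Polynomial.smult (B f (q m)) (p m)) = (\<Sum>m=n..N. Polynomial.smult (B f (q m)) (p m))"
    by (rule sum.mono_neutral_right) (use assms(2) in auto)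
  with orthogonal_expansion[OF assms(1)] show ?thesis by simp
qed

lemma orthogonal_lower_degree:
  assumes "degree f < n"
  shows "B f (q n) = 0"
proof -
  have "f = (\<Sum>m\<le>n - 1. Polynomial.smult (B f (q m)) (p m))"
    using assms by (intro orthogonal_expansion) auto
  then have "B f (q n) = (\<Sum>m\<le>n - 1. B f (q m) * B (p m) (q n))"
    by (metis sum_left)
  also have "\<dots> = 0" using assms by (intro sum.neutral) (auto simp: biorthonormal)
  finally show ?thesis .
qed

text \<open>Only the term with \<open>p n\<close> in the expansion of \<open>f\<close> reaches
  degree n.\<close>

lemma pairing_top:
  assumes "degree f \<le> n"
  shows "B f (q n) = coeff f n / lead_coeff (p n)"
proof -
  have lc: "coeff (p n) n \<noteq> 0" by (metis degree_left left_nonzero leading_coeff_0_iff)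
  have "coeff f n = coeff (\<Sum>m\<le>n. Polynomial.smult (B f (q m)) (p m)) n"
    using orthogonal_expansion[OF assms] by simp
  also have "\<dots> = (\<Sum>m\<le>n. B f (q m) * coeff (p m) n)" by (simp add: coeff_sum)
  also have "\<dots> = (\<Sum>m\<in>{n}. B f (q m) * coeff (p m) n)"
    by (rule sum.mono_neutral_right) (auto simp: coeff_eq_0 degree_left)
  finally show ?thesis using lc by (simp add: degree_left)
qed

lemma swap: "biorthogonal_pair (\<lambda>f g. B g f) q p"
  by unfold_locales
    (simp_all add: add_left add_right smult_left smult_right degree_left degree_right
       left_nonzero right_nonzero biorthonormal)

end

section \<open>Integration over the unit circle against a weight\<close>

text \<open>The derivative 2 \<pi> i \<zeta> of the path cancels the denominator.\<close>

lemma circle_integral_eq: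
  "circle_integral f = integral {0..1} (\<lambda>t. f (circlepath 0 1 t))"
proof -
  have "f (circlepath 0 1 t) / (2 * complex_of_real pi * \<i> * circlepath 0 1 t) *
      vector_derivative (circlepath 0 1) (at t) = f (circlepath 0 1 t)" for t
    by (simp add: vector_derivative_circlepath) (simp add: circlepath)
  then show ?thesis
    by (simp add: circle_integral_def contour_integral_integral)
qed

lemma circlepath_in_sphere: "circlepath 0 1 t \<in> sphere 0 1"
  by (simp add: circlepath)

lemma circle_integral_cong:
  assumes "\<And>\<zeta>. \<zeta> \<in> sphere 0 1 \<Longrightarrow> f \<zeta> = g \<zeta>"
  shows "circle_integral f = circle_integral g"
  unfolding circle_integral_eq using assms circlepath_in_sphere by (metis (no_types, lifting))

text \<open>A continuous factor is bounded and measurable on the compact circle, so it preserves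
  absolute integrability. This secures the additivity of the integrals below.\<close>

lemma weight_mult_continuous:
  assumes w: "weight_on_circle w" and g: "continuous_on (sphere 0 1) g"
  shows "weight_on_circle (\<lambda>\<zeta>. w \<zeta> * g \<zeta>)"
proof -
  have cont: "continuous_on {0..1} (\<lambda>t. g (circlepath 0 1 t))"
    by (rule continuous_on_compose2[OF g])
      (use circlepath_in_sphere in \<open>auto simp: circlepath intro!: continuous_intros\<close>)
  have "(\<lambda>t. g (circlepath 0 1 t) * w (circlepath 0 1 t)) absolutely_integrable_on {0..1}"
  proof (rule absolutely_integrable_bounded_measurable_product[OF bilinear_times])
    show "(\<lambda>t. g (circlepath 0 1 t)) \<in> borel_measurable (lebesgue_on {0..1})"
      using cont by (intro continuous_imp_measurable_on_sets_lebesgue) auto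
    show "bounded ((\<lambda>t. g (circlepath 0 1 t)) ` {0..1})"
      by (intro compact_imp_bounded compact_continuous_image cont) auto
  qed (use w in \<open>auto simp: weight_on_circle_def\<close>)
  then show ?thesis by (simp add: weight_on_circle_def mult.commute)
qed

lemma weight_integrable:
  assumes "weight_on_circle w" "continuous_on (sphere 0 1) g"
  shows "(\<lambda>t. w (circlepath 0 1 t) * g (circlepath 0 1 t)) integrable_on {0..1}"
  using weight_mult_continuous[OF assms]
  by (simp add: weight_on_circle_def set_lebesgue_integral_eq_integral(1))

lemma circle_integral_add:
  assumes "weight_on_circle w" "continuous_on (sphere 0 1) f" "continuous_on (sphere 0 1) g"
  shows "circle_integral (\<lambda>\<zeta>. w \<zeta> * (f \<zeta> + g \<zeta>)) =
    circle_integral (\<lambda>\<zeta>. w \<zeta> * f \<zeta>) + circle_integral (\<lambda>\<zeta>. w \<zeta> * g \<zeta>)"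
  unfolding circle_integral_eq
  by (simp add: ring_distribs integral_add weight_integrable assms)

lemma circle_integral_cmult:
  "circle_integral (\<lambda>\<zeta>. w \<zeta> * (c * f \<zeta>)) = c * circle_integral (\<lambda>\<zeta>. w \<zeta> * f \<zeta>)"
  unfolding circle_integral_eq by (simp add: mult.left_commute)

lemma circle_integral_sum:
  assumes "weight_on_circle w" "\<And>i. i \<in> I \<Longrightarrow> continuous_on (sphere 0 1) (f i)"
  shows "circle_integral (\<lambda>\<zeta>. w \<zeta> * (\<Sum>i\<in>I. c i * f i \<zeta>)) =
    (\<Sum>i\<in>I. c i * circle_integral (\<lambda>\<zeta>. w \<zeta> * f i \<zeta>))"
  using assms(2)
proof (induction I rule: infinite_finite_induct)
  case (insert i I)
  then have "circle_integral (\<lambda>\<zeta>. w \<zeta> * (c i * f i \<zeta> + (\<Sum>i\<in>I. c i * f i \<zeta>))) =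
    circle_integral (\<lambda>\<zeta>. w \<zeta> * (c i * f i \<zeta>)) + circle_integral (\<lambda>\<zeta>. w \<zeta> * (\<Sum>i\<in>I. c i * f i \<zeta>))"
    by (intro circle_integral_add assms(1) continuous_intros) auto
  with insert show ?case by (simp add: circle_integral_cmult)
qed (simp_all add: circle_integral_eq)

lemma continuous_on_poly_inverse:
  "continuous_on (sphere 0 1) (\<lambda>\<zeta>::complex. poly q (1 / \<zeta>))"
  by (intro continuous_intros) auto

section \<open>The bilinear form of a weight, and reversal of polynomials\<close>

text \<open>On monomials of degrees j and k this is \<open>fourier_coeff w (int k - int j)\<close>,
  an entry of a Toeplitz matrix. The form is bilinear, without conjugation of coefficients.\<close>

definition toeplitz_form ::
    "(complex \<Rightarrow> complex) \<Rightarrow> complex poly \<Rightarrow> complex poly \<Rightarrow> complex" where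
  "toeplitz_form w p q = circle_integral (\<lambda>\<zeta>. w \<zeta> * (poly p \<zeta> * poly q (1 / \<zeta>)))"

lemma toeplitz_form_cong:
  assumes "\<And>\<zeta>. \<zeta> \<in> sphere 0 1 \<Longrightarrow> poly p \<zeta> * poly q (1 / \<zeta>) = poly f \<zeta> * poly g (1 / \<zeta>)"
  shows "toeplitz_form w p q = toeplitz_form w f g"
  unfolding toeplitz_form_def by (rule circle_integral_cong) (simp add: assms)

lemma biorthogonal_system_pair:
  assumes w: "weight_on_circle w" and sys: "biorthogonal_system w \<kappa> \<phi> \<phi>b"
  shows "biorthogonal_pair (toeplitz_form w) \<phi> \<phi>b"
proof
  note c = continuous_on_poly_inverse
  show on: "toeplitz_form w (\<phi> m) (\<phi>b n) = (if m = n then 1 else 0)" for m n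
    using sys by (simp add: biorthogonal_system_def toeplitz_form_def mult.assoc)
  show "toeplitz_form w (f + g) h = toeplitz_form w f h + toeplitz_form w g h" for f g h
    unfolding toeplitz_form_def poly_add distrib_right
    by (intro circle_integral_add w continuous_intros c)
  show "toeplitz_form w h (f + g) = toeplitz_form w h f + toeplitz_form w h g" for f g h
    unfolding toeplitz_form_def poly_add distrib_left[of "poly h _"]
    by (intro circle_integral_add w continuous_intros c)
  show "toeplitz_form w (Polynomial.smult a f) h = a * toeplitz_form w f h" for a f h
    unfolding toeplitz_form_def poly_smult mult.assoc by (rule circle_integral_cmult)
  show "toeplitz_form w h (Polynomial.smult a f) = a * toeplitz_form w h f" for a f h
    unfolding toeplitz_form_def poly_smult mult.left_commute[of "poly h _" a] by (rule circle_integral_cmult)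
  show "degree (\<phi> m) = m" "degree (\<phi>b m) = m" for m
    using sys by (simp_all add: biorthogonal_system_def)
  show "\<phi> m \<noteq> 0" "\<phi>b m \<noteq> 0" for m
    using on[of m m] by (auto simp: toeplitz_form_def circle_integral_eq)
qed

(* Unlike reflect_poly, which uses the actual degree, this is p \<mapsto> z^n p(1/z) for a given n \<ge> degree p,
   and it is an involution on the polynomials of degree at most n. *)
definition flip_poly :: "nat \<Rightarrow> 'a::zero poly \<Rightarrow> 'a poly" where
  "flip_poly n p = Abs_poly (\<lambda>i. if i \<le> n then coeff p (n - i) else 0)"

lemma coeff_flip_poly: "coeff (flip_poly n p) i = (if i \<le> n then coeff p (n - i) else 0)"
  unfolding flip_poly_def by (subst coeff_Abs_poly[of n]) auto

lemma degree_flip_poly_le: "degree (flip_poly n p) \<le> n"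
  by (rule degree_le) (simp add: coeff_flip_poly)

lemma flip_poly_flip_poly: "degree p \<le> n \<Longrightarrow> flip_poly n (flip_poly n p) = p"
  by (rule poly_eqI) (auto simp: coeff_flip_poly coeff_eq_0)

lemma flip_poly_smult: "flip_poly n (Polynomial.smult c p) = Polynomial.smult c (flip_poly n p)"
  by (rule poly_eqI) (simp add: coeff_flip_poly)

lemma flip_poly_degree: "flip_poly (degree p) p = reflect_poly p"
  by (rule poly_eqI) (simp add: coeff_flip_poly coeff_reflect_poly)

lemma poly_eq_sum_atMost:
  fixes p :: "'a::comm_semiring_1 poly"
  assumes "degree p \<le> n"
  shows "poly p z = (\<Sum>i\<le>n. coeff p i * z ^ i)"
  unfolding poly_altdef
  by (rule sum.mono_neutral_left) (use assms in \<open>auto simp: coeff_eq_0\<close>)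

lemma poly_flip_poly:
  fixes p :: "'a::field poly"
  assumes "degree p \<le> n" "z \<noteq> 0"
  shows "poly (flip_poly n p) z = z ^ n * poly p (1 / z)"
proof -
  have "poly (flip_poly n p) z = (\<Sum>i\<le>n. coeff p (n - i) * z ^ i)"
    by (simp add: poly_eq_sum_atMost[OF degree_flip_poly_le] coeff_flip_poly)
  also have "\<dots> = (\<Sum>i\<le>n. coeff p i * z ^ (n - i))"
    by (rule sum.reindex_bij_witness[of _ "\<lambda>i. n - i" "\<lambda>i. n - i"]) auto
  also have "\<dots> = z ^ n * poly p (1 / z)"
    unfolding poly_eq_sum_atMost[OF assms(1)] sum_distrib_left
    using assms(2) by (intro sum.cong) (auto simp: power_diff field_simps)
  finally show ?thesis .
qed

lemma weight_on_circle_modified: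
  assumes "weight_on_circle w"
  shows "weight_on_circle (modified_weight K \<alpha> w)"
proof -
  have "weight_on_circle (\<lambda>\<zeta>. w \<zeta> * poly (node_poly K \<alpha>) \<zeta>)"
    by (intro weight_mult_continuous assms continuous_intros)
  then show ?thesis
    by (simp add: poly_node_poly weight_on_circle_def modified_weight_def mult.commute)
qed

lemma toeplitz_form_modified:
  "toeplitz_form (modified_weight K \<alpha> w) f g = toeplitz_form w (node_poly K \<alpha> * f) g"
  by (simp add: toeplitz_form_def modified_weight_def poly_node_poly ac_simps)

text \<open>The factor 1 / \<zeta> from \<open>pCons 0 r\<close> lowers \<zeta>^m to the power
  needed to flip \<open>r\<close>. Thus orthogonality of a flipped polynomial to \<zeta>, ...,
  \<zeta>^m becomes orthogonality of \<open>p\<close> to degrees below m.\<close>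

lemma toeplitz_form_flip_left:
  assumes "degree p \<le> m" "degree r < m"
  shows "toeplitz_form w (flip_poly m p) (pCons 0 r) = toeplitz_form w (flip_poly (m - 1) r) p"
proof (rule toeplitz_form_cong)
  fix \<zeta> :: complex
  assume "\<zeta> \<in> sphere 0 1"
  then have "\<zeta> \<noteq> 0" by auto
  then show "poly (flip_poly m p) \<zeta> * poly (pCons 0 r) (1 / \<zeta>) =
      poly (flip_poly (m - 1) r) \<zeta> * poly p (1 / \<zeta>)"
    using assms by (simp add: poly_flip_poly power_eq_if)
qed

lemma continuous_on_kernel:
  "norm z \<noteq> 1 \<Longrightarrow> continuous_on (sphere 0 1) (\<lambda>\<zeta>::complex. (\<zeta> + z) / (\<zeta> - z))"
  by (intro continuous_intros) auto

section \<open>The biorthogonal system of a weight and its reciprocal polynomials\<close>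

locale circle_biorthogonal =
  fixes w :: "complex \<Rightarrow> complex" and \<kappa> :: "nat \<Rightarrow> complex" and \<phi> \<phi>b :: "nat \<Rightarrow> complex poly"
  assumes weight: "weight_on_circle w"
    and system: "biorthogonal_system w \<kappa> \<phi> \<phi>b"
    and generic: "generic_system \<kappa> \<phi> \<phi>b"
begin

sublocale pair: biorthogonal_pair "toeplitz_form w" \<phi> \<phi>b
  by (rule biorthogonal_system_pair[OF weight system])

sublocale swapped: biorthogonal_pair "\<lambda>f g. toeplitz_form w g f" \<phi>b \<phi>
  by (rule pair.swap)

lemma lead_coeffs: "lead_coeff (\<phi> n) = \<kappa> n" "lead_coeff (\<phi>b n) = \<kappa> n"
  using system unfolding biorthogonal_system_def by blast+

lemma top_coeffs: "coeff (\<phi> n) n = \<kappa> n" "coeff (\<phi>b n) n = \<kappa> n"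
  using lead_coeffs[of n] by (simp_all add: pair.degree_left pair.degree_right)

lemma kappa_nonzero: "\<kappa> n \<noteq> 0"
  using lead_coeffs(1)[of n] pair.left_nonzero[of n] by auto

text \<open>Genericity covers n \<ge> 1; for n = 0 the constant coefficient is the leading
  one.\<close>

lemma \<phi>b_0_nonzero: "coeff (\<phi>b n) 0 \<noteq> 0"
proof (cases "n = 0")
  case True
  then show ?thesis using top_coeffs(2)[of 0] kappa_nonzero[of 0] by simp
next
  case False
  then show ?thesis using generic by (auto simp: generic_system_def r_coeff_def poly_0_coeff_0)
qed

lemma reciprocal_eq_flip: "reciprocal \<phi>b n = flip_poly n (\<phi>b n)"
  using flip_poly_degree[of "\<phi>b n"] by (simp add: reciprocal_def pair.degree_right)

lemma degree_reciprocal: "degree (reciprocal \<phi>b n) = n"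
  using \<phi>b_0_nonzero[of n] by (simp add: reciprocal_def pair.degree_right)

lemma reciprocal_nonzero: "reciprocal \<phi>b n \<noteq> 0"
  by (simp add: reciprocal_def pair.right_nonzero)

lemma lead_coeff_reciprocal: "lead_coeff (reciprocal \<phi>b n) = poly (\<phi>b n) 0"
  unfolding degree_reciprocal by (simp add: reciprocal_eq_flip coeff_flip_poly poly_0_coeff_0)

lemma poly_reciprocal_0: "poly (reciprocal \<phi>b n) 0 = \<kappa> n"
  using lead_coeffs(2)[of n] by (simp add: reciprocal_def)

lemma poly_reciprocal: "z \<noteq> 0 \<Longrightarrow> poly (reciprocal \<phi>b n) z = z ^ n * poly (\<phi>b n) (1 / z)"
  by (simp add: reciprocal_eq_flip poly_flip_poly pair.degree_right)

lemma reciprocal_orthogonal: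
  assumes "degree r < n"
  shows "toeplitz_form w (reciprocal \<phi>b n) (pCons 0 r) = 0"
proof -
  have "degree (flip_poly (n - 1) r) < n"
    using assms degree_flip_poly_le[of "n - 1" r] by linarith
  then show ?thesis
    using assms
    by (simp add: reciprocal_eq_flip toeplitz_form_flip_left pair.degree_right
        pair.orthogonal_lower_degree)
qed

(* Flipping turns f into a polynomial orthogonal to 1, ..., \<zeta>^(n-1) on the other side of the form. *)
lemma reciprocal_unique:
  assumes f: "degree f \<le> n" and orth: "\<And>r. degree r < n \<Longrightarrow> toeplitz_form w f (pCons 0 r) = 0"
  shows "\<exists>c. f = Polynomial.smult c (reciprocal \<phi>b n)"
proof -
  have "toeplitz_form w (\<phi> m) (flip_poly n f) = 0" if m: "m < n" for m
  proof -
    have "degree (flip_poly (n - 1) (\<phi> m)) < n"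
      using m degree_flip_poly_le[of "n - 1" "\<phi> m"] by linarith
    then have "toeplitz_form w f (pCons 0 (flip_poly (n - 1) (\<phi> m))) =
        toeplitz_form w (\<phi> m) (flip_poly n f)"
      using toeplitz_form_flip_left[of "flip_poly n f" n "flip_poly (n - 1) (\<phi> m)" w] f m
      by (simp add: degree_flip_poly_le flip_poly_flip_poly pair.degree_left)
    with orth[OF \<open>degree (flip_poly (n - 1) (\<phi> m)) < n\<close>] show ?thesis by simp
  qed
  then have "flip_poly n f = (\<Sum>m=n..n. Polynomial.smult (toeplitz_form w (\<phi> m) (flip_poly n f)) (\<phi>b m))"
    by (intro swapped.orthogonal_span degree_flip_poly_le)
  then obtain c where "flip_poly n f = Polynomial.smult c (\<phi>b n)" by auto
  then have "f = Polynomial.smult c (flip_poly n (\<phi>b n))"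
    by (metis f flip_poly_flip_poly flip_poly_smult)
  then show ?thesis unfolding reciprocal_eq_flip by blast
qed

text \<open>Induction on \<open>N\<close>: subtracting a multiple of the top reciprocal lowers the
  degree and keeps the orthogonality to \<zeta>, ..., \<zeta>^n; the base case is
  \<open>reciprocal_unique\<close>.\<close>

lemma reciprocal_span:
  assumes "n \<le> N" "degree f \<le> N" "\<And>r. degree r < n \<Longrightarrow> toeplitz_form w f (pCons 0 r) = 0"
  shows "\<exists>c. f = (\<Sum>m=n..N. Polynomial.smult (c m) (reciprocal \<phi>b m))"
  using assms
proof (induction N arbitrary: f rule: dec_induct)
  case base
  then obtain c where "f = Polynomial.smult c (reciprocal \<phi>b n)"
    using reciprocal_unique by blast
  then show ?case by auto
next
  case (step N)
  let ?R = "reciprocal \<phi>b (Suc N)"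
  define a where "a = coeff f (Suc N) / lead_coeff ?R"
  define g where "g = f + Polynomial.smult (- a) ?R"
  have lc: "coeff ?R (Suc N) \<noteq> 0"
    using reciprocal_nonzero[of "Suc N"] degree_reciprocal[of "Suc N"] by (metis leading_coeff_0_iff)
  have "coeff g i = 0" if "i > N" for i
    using that lc step.prems(1) degree_reciprocal[of "Suc N"]
    by (cases "i = Suc N") (auto simp: g_def a_def coeff_eq_0)
  then have "degree g \<le> N" by (simp add: degree_le)
  moreover have "toeplitz_form w g (pCons 0 r) = 0" if "degree r < n" for r
    using that step by (simp add: g_def pair.add_left pair.smult_left reciprocal_orthogonal
        del: smult_minus_left)
  ultimately obtain c where c: "g = (\<Sum>m=n..N. Polynomial.smult (c m) (reciprocal \<phi>b m))"
    using step.IH by blast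
  have "f = g + Polynomial.smult a ?R" by (simp add: g_def)
  also have "\<dots> = (\<Sum>m=n..Suc N. Polynomial.smult ((c(Suc N := a)) m) (reciprocal \<phi>b m))"
    using step.hyps by (simp add: c)
  finally show ?case by blast
qed

section \<open>Moments and associated functions\<close>

lemma toeplitz_form_1:
  "toeplitz_form w (\<phi> n) 1 = (if n = 0 then \<kappa> 0 * fourier_coeff w 0 else 0)"
proof (cases "n = 0")
  case True
  then have "\<phi> n = [:\<kappa> 0:]"
    using pair.degree_left[of n] top_coeffs(1)[of n] by (metis coeff_pCons_0 degree_eq_zeroE)
  then show ?thesis
    using circle_integral_cmult[of w "\<kappa> 0" "\<lambda>_. 1"] True
    by (simp add: toeplitz_form_def fourier_coeff_def)
next
  case False
  then show ?thesis by (simp add: swapped.orthogonal_lower_degree)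
qed

text \<open>On the circle the factor \<zeta>^n of the reciprocal can be split off, which leaves the
  pairing of \<zeta>^n with \<open>\<phi>b n\<close>.\<close>

lemma toeplitz_form_reciprocal_1: "toeplitz_form w (reciprocal \<phi>b n) 1 = 1 / \<kappa> n"
proof -
  have "toeplitz_form w (reciprocal \<phi>b n) 1 = toeplitz_form w (monom 1 n) (\<phi>b n)"
    by (rule toeplitz_form_cong, subst poly_reciprocal) (auto simp: poly_monom)
  also have "\<dots> = 1 / \<kappa> n"
    using lead_coeffs(1)[of n] by (subst pair.pairing_top) (auto simp: degree_monom_le)
  finally show ?thesis .
qed

(* The added 1 contributes \<integral> w \<phi>\<^sub>n, which is \<kappa>\<^sub>0 w\<^sub>0 for n = 0 and 0 otherwise; so the exceptional
   definition at n = 0 is absorbed and the function is linear in \<phi>\<^sub>n. *)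
lemma assoc_fun_eq:
  assumes z: "norm z \<noteq> 1"
  shows "assoc_fun w \<kappa> \<phi> n z =
    circle_integral (\<lambda>\<zeta>. w \<zeta> * (poly (\<phi> n) \<zeta> * (1 + (\<zeta> + z) / (\<zeta> - z))))"
proof -
  have "circle_integral (\<lambda>\<zeta>. w \<zeta> * (poly (\<phi> n) \<zeta> * (1 + (\<zeta> + z) / (\<zeta> - z)))) =
      toeplitz_form w (\<phi> n) 1 + circle_integral (\<lambda>\<zeta>. w \<zeta> * (poly (\<phi> n) \<zeta> * ((\<zeta> + z) / (\<zeta> - z))))"
    unfolding toeplitz_form_def distrib_left[of "poly _ _"] poly_1
    by (intro circle_integral_add weight continuous_on_mult[OF _ continuous_on_kernel[OF z]]
        continuous_intros)
  moreover have "circle_integral (\<lambda>\<zeta>. w \<zeta> * (poly (\<phi> 0) \<zeta> * ((\<zeta> + z) / (\<zeta> - z)))) = \<kappa> 0 * carath w z"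
  proof -
    have "\<phi> 0 = [:\<kappa> 0:]"
      using pair.degree_left[of 0] top_coeffs(1)[of 0] by (metis coeff_pCons_0 degree_eq_zeroE)
    then show ?thesis
      using circle_integral_cmult[of w "\<kappa> 0" "\<lambda>\<zeta>. (\<zeta> + z) / (\<zeta> - z)"]
      by (simp add: carath_def mult.commute)
  qed
  ultimately show ?thesis
    by (simp add: assoc_fun_def toeplitz_form_1 distrib_left[of "\<kappa> 0"] ac_simps)
qed

text \<open>The factor z^n of the definition is traded for \<zeta>^n, at the cost of 1 / \<kappa> n,
  which the summand 1 supplies. The result is one linear functional of
  \<open>reciprocal \<phi>b n\<close> for all n, including 0.\<close>

lemma assoc_fun_star_eq:
  assumes z: "norm z \<noteq> 1"
  shows "assoc_fun_star w \<kappa> \<phi>b n z =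
    circle_integral (\<lambda>\<zeta>. w \<zeta> * (poly (reciprocal \<phi>b n) \<zeta> * (1 - (\<zeta> + z) / (\<zeta> - z))))"
proof -
  let ?k = "\<lambda>\<zeta>. (\<zeta> + z) / (\<zeta> - z)"
  have "circle_integral (\<lambda>\<zeta>. w \<zeta> * (poly (reciprocal \<phi>b n) \<zeta> * (1 - ?k \<zeta>))) =
    circle_integral (\<lambda>\<zeta>. w \<zeta> * (poly (reciprocal \<phi>b n) \<zeta> * poly 1 (1 / \<zeta>) +
       (- 1) * (poly (reciprocal \<phi>b n) \<zeta> * ?k \<zeta>)))"
    by (simp add: right_diff_distrib)
  also have "\<dots> = toeplitz_form w (reciprocal \<phi>b n) 1 +
      circle_integral (\<lambda>\<zeta>. w \<zeta> * ((- 1) * (poly (reciprocal \<phi>b n) \<zeta> * ?k \<zeta>)))"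
    unfolding toeplitz_form_def
    by (intro circle_integral_add weight continuous_on_mult[OF _ continuous_on_kernel[OF z]]
        continuous_intros continuous_on_poly_inverse)
  finally have eq: "circle_integral (\<lambda>\<zeta>. w \<zeta> * (poly (reciprocal \<phi>b n) \<zeta> * (1 - ?k \<zeta>))) =
      1 / \<kappa> n - circle_integral (\<lambda>\<zeta>. w \<zeta> * (poly (reciprocal \<phi>b n) \<zeta> * ?k \<zeta>))"
    unfolding circle_integral_cmult toeplitz_form_reciprocal_1 by simp
  show ?thesis
  proof (cases "n = 0")
    case True
    \<comment> \<open>The polynomials are constant and equal, so the two moment lemmas evaluate the
      same integral.\<close>
    have "\<phi> 0 = [:\<kappa> 0:]" "\<phi>b 0 = [:\<kappa> 0:]"
      using pair.degree_left[of 0] pair.degree_right[of 0] top_coeffs[of 0]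
      by (metis coeff_pCons_0 degree_eq_zeroE)+
    moreover from this have "\<kappa> 0 * fourier_coeff w 0 = 1 / \<kappa> 0"
      using toeplitz_form_1[of 0] toeplitz_form_reciprocal_1[of 0] by (simp add: reciprocal_def)
    moreover have "circle_integral (\<lambda>\<zeta>. w \<zeta> * (\<kappa> 0 * ?k \<zeta>)) = \<kappa> 0 * carath w z"
      unfolding circle_integral_cmult by (simp add: carath_def mult.commute)
    ultimately show ?thesis
      using True unfolding eq by (simp add: assoc_fun_star_def reciprocal_def right_diff_distrib)
  next
    case False
    (* The kernel times \<zeta>^n - z^n is the polynomial g of degree n, which \<phi>b n pairs to 1 / \<kappa> n. *)
    define S where "S = (\<Sum>i<n. monom (z ^ (n - Suc i)) i)"
    define g where "g = [:z, 1:] * S"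
    \<comment> \<open>\<open>S\<close> is the quotient of \<zeta>^n - z^n by \<zeta> - z, monic of
      degree n - 1.\<close>
    have sum: "degree S \<le> n - 1"
      unfolding S_def by (intro degree_sum_le) (auto intro!: order_trans[OF degree_monom_le])
    have g_deg: "degree g \<le> n"
      using sum False unfolding g_def
      by (intro order_trans[OF degree_mult_le]) auto
    have "coeff S n = 0"
      using sum False by (intro coeff_eq_0) auto
    moreover have "coeff S (n - 1) = 1"
      using False by (simp add: S_def coeff_sum if_distrib cong: if_cong)
    ultimately have g_top: "coeff g n = 1"
      using False by (cases n) (simp_all add: g_def)
    have g: "poly g \<zeta> * poly (\<phi>b n) (1 / \<zeta>) =
        poly (reciprocal \<phi>b n) \<zeta> * ?k \<zeta> + (- (z ^ n)) * (poly (\<phi>b n) (1 / \<zeta>) * ?k \<zeta>)"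
      if "\<zeta> \<in> sphere 0 1" for \<zeta>
    proof -
      have \<zeta>: "\<zeta> \<noteq> z" "\<zeta> \<noteq> 0" using that z by auto
      have "(\<zeta> - z) * poly g \<zeta> = (\<zeta> + z) * (\<zeta> ^ n - z ^ n)"
        unfolding power_diff_sumr2[of \<zeta>]
        by (simp add: g_def S_def poly_sum poly_monom algebra_simps)
      then have "poly g \<zeta> = ?k \<zeta> * (\<zeta> ^ n - z ^ n)"
        using \<zeta> by (simp add: field_simps)
      moreover have "k * (x - y) * b = x * b * k + (- y) * (b * k)" for k x y b :: complex
        by (simp add: algebra_simps)
      ultimately show ?thesis by (simp only: poly_reciprocal[OF \<zeta>(2)])
    qed
    have "1 / \<kappa> n = toeplitz_form w g (\<phi>b n)"
      using g_deg g_top by (simp add: pair.pairing_top lead_coeffs)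
    also have "\<dots> = circle_integral (\<lambda>\<zeta>. w \<zeta> *
        (poly (reciprocal \<phi>b n) \<zeta> * ?k \<zeta> + (- (z ^ n)) * (poly (\<phi>b n) (1 / \<zeta>) * ?k \<zeta>)))"
      unfolding toeplitz_form_def using g by (intro circle_integral_cong) simp
    also have "\<dots> = circle_integral (\<lambda>\<zeta>. w \<zeta> * (poly (reciprocal \<phi>b n) \<zeta> * ?k \<zeta>)) +
        circle_integral (\<lambda>\<zeta>. w \<zeta> * ((- (z ^ n)) * (poly (\<phi>b n) (1 / \<zeta>) * ?k \<zeta>)))"
      by (intro circle_integral_add weight continuous_on_mult[OF _ continuous_on_kernel[OF z]]
          continuous_intros continuous_on_poly_inverse)
    finally show ?thesis
      using False unfolding eq circle_integral_cmult
      by (simp add: assoc_fun_star_def ac_simps)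
  qed
qed

end

section \<open>Transfer to the modified weight and the determinant formulas\<close>

text \<open>The node polynomial moves from the weight to \<open>f\<close>, where the expansion is
  available. The choices of \<open>h\<close> below are 1 plus or minus the kernel, and the constant
  1.\<close>

lemma circle_integral_modified_sum:
  assumes "weight_on_circle w" "continuous_on (sphere 0 1) h" "finite I"
    and "node_poly K \<alpha> * f = (\<Sum>m\<in>I. Polynomial.smult (c m) (a m))"
  shows "circle_integral (\<lambda>\<zeta>. modified_weight K \<alpha> w \<zeta> * (poly f \<zeta> * h \<zeta>)) =
    (\<Sum>m\<in>I. c m * circle_integral (\<lambda>\<zeta>. w \<zeta> * (poly (a m) \<zeta> * h \<zeta>)))"
proof -
  have "modified_weight K \<alpha> w \<zeta> * (poly f \<zeta> * h \<zeta>) = w \<zeta> * (\<Sum>m\<in>I. c m * (poly (a m) \<zeta> * h \<zeta>))" for \<zeta>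
    using arg_cong[OF assms(4), of "\<lambda>p. poly p \<zeta>"]
    by (simp add: modified_weight_def poly_node_poly poly_sum sum_distrib_right[symmetric]
        mult.assoc[symmetric])
  then show ?thesis
    using circle_integral_sum[of w I "\<lambda>m \<zeta>. poly (a m) \<zeta> * h \<zeta>" c] assms
    by (simp add: continuous_intros)
qed

theorem proposition3p1:
  fixes w :: "complex \<Rightarrow> complex"
    and \<kappa> \<kappa>h :: "nat \<Rightarrow> complex"
    and \<phi> \<phi>b \<Phi> \<Phi>b :: "nat \<Rightarrow> complex poly"
    and \<alpha> :: "nat \<Rightarrow> complex"
    and K n :: nat
  assumes "K \<ge> 1"
    and "inj_on \<alpha> {1..K}"
    and "weight_on_circle w"
    and "biorthogonal_system w \<kappa> \<phi> \<phi>b"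
    and "generic_system \<kappa> \<phi> \<phi>b"
    and "biorthogonal_system (modified_weight K \<alpha> w) \<kappa>h \<Phi> \<Phi>b"
    and "generic_system \<kappa>h \<Phi> \<Phi>b"
  shows
    "(\<forall>z. (\<Prod>j=1..K. z - \<alpha> j) * poly (\<Phi> n) z =
        (-1) ^ K * (\<kappa>h n / \<kappa> (n + K)) *
        (det_v n K \<alpha> (v_row n K (polys \<phi>) z) (polys \<phi>) / det_u n K \<alpha> (polys \<phi>))) \<and>
     (\<forall>z. (\<Prod>j=1..K. z - \<alpha> j) * poly (reciprocal \<Phi>b n) z =
        (-1) ^ K * (poly (\<Phi>b n) 0 / poly (\<phi>b (n + K)) 0) *
        (det_v n K \<alpha> (v_row n K (polys (reciprocal \<phi>b)) z) (polys (reciprocal \<phi>b)) /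
         det_u n K \<alpha> (polys (reciprocal \<phi>b)))) \<and>
     (\<forall>z. norm z \<noteq> 1 \<longrightarrow>
        assoc_fun (modified_weight K \<alpha> w) \<kappa>h \<Phi> n z =
        (-1) ^ K * (\<kappa>h n / \<kappa> (n + K)) *
        (det_v n K \<alpha> (v_row n K (assoc_fun w \<kappa> \<phi>) z) (polys \<phi>) / det_u n K \<alpha> (polys \<phi>))) \<and>
     (\<forall>z. norm z \<noteq> 1 \<longrightarrow>
        assoc_fun_star (modified_weight K \<alpha> w) \<kappa>h \<Phi>b n z =
        (-1) ^ K * (poly (\<Phi>b n) 0 / poly (\<phi>b (n + K)) 0) *
        (det_v n K \<alpha> (v_row n K (assoc_fun_star w \<kappa> \<phi>b) z) (polys (reciprocal \<phi>b)) /
         det_u n K \<alpha> (polys (reciprocal \<phi>b)))) \<and>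
     ((\<forall>i\<in>{1..K}. \<alpha> i \<noteq> 0) \<longrightarrow>
        (\<Prod>i=1..K. \<alpha> i) * (\<kappa>h n)\<^sup>2 =
          (-1) ^ K *
          (det_v n K \<alpha> (segment n (K + 1) \<kappa>) (polys (reciprocal \<phi>b)) /
           det_v n K \<alpha> (segment n (K + 1) (\<lambda>m. 1 / \<kappa> m)) (polys (reciprocal \<phi>b))) \<and>
        r_coeff \<kappa>h \<Phi> n =
          1 / (\<kappa> (n + K) * (\<Prod>i=1..K. \<alpha> i)) *
          (det_v n K \<alpha> (v_row n K (polys \<phi>) 0) (polys \<phi>) / det_u n K \<alpha> (polys \<phi>)) \<and>
        r_coeff \<kappa>h \<Phi>b n =
          poly (\<phi>b (n + K)) 0 * (\<Prod>i=1..K. \<alpha> i) *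
          (det_u n K \<alpha> (polys (reciprocal \<phi>b)) /
           det_v n K \<alpha> (segment n (K + 1) \<kappa>) (polys (reciprocal \<phi>b))))"
proof -
  let ?P = "node_poly K \<alpha>" and ?wh = "modified_weight K \<alpha> w"
  let ?R = "reciprocal \<phi>b" and ?Rh = "reciprocal \<Phi>b"
  interpret o: circle_biorthogonal w \<kappa> \<phi> \<phi>b
    using assms by unfold_locales
  interpret m: circle_biorthogonal ?wh \<kappa>h \<Phi> \<Phi>b
    using assms weight_on_circle_modified by unfold_locales auto
  have deg_le: "degree (?P * f) \<le> n + K" if "degree f \<le> n" for f
    using that degree_mult_le[of ?P f] by (simp add: degree_node_poly)

  obtain c where c: "?P * \<Phi> n = (\<Sum>m=n..n + K. Polynomial.smult (c m) (\<phi> m))"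
  proof -
    have "toeplitz_form w (?P * \<Phi> n) (\<phi>b m) = 0" if "m < n" for m
      unfolding toeplitz_form_modified[symmetric] using that
      by (intro m.swapped.orthogonal_lower_degree) (simp add: o.pair.degree_right)
    then show thesis
      using that o.pair.orthogonal_span[of "?P * \<Phi> n" "n + K" n] deg_le[of "\<Phi> n"]
      by (simp add: m.pair.degree_left)
  qed
  have indep: "\<forall>Q e. degree Q < n \<longrightarrow>
      ?P * Q = (\<Sum>m=n..<n + K. Polynomial.smult (e m) (\<phi> m)) \<longrightarrow> Q = 0"
  proof (intro allI impI)
    fix Q e
    assume Q: "degree Q < n" "?P * Q = (\<Sum>m=n..<n + K. Polynomial.smult (e m) (\<phi> m))"
    have "toeplitz_form ?wh Q (\<Phi>b m) = 0" if "m < n" for m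
      unfolding toeplitz_form_modified Q(2) o.pair.sum_left using that
      by (intro sum.neutral) (auto simp: m.pair.degree_right o.swapped.orthogonal_lower_degree)
    \<comment> \<open>The degree bound forces n > 0, so the range from n to n - 1 is empty.\<close>
    then show "Q = 0"
      using m.pair.orthogonal_span[of Q "n - 1" n] Q(1) by simp
  qed
  note \<phi> = linear_form_eq_det_ratio[OF assms(2) o.pair.degree_left o.pair.left_nonzero
      m.pair.degree_left c indep,
      unfolded o.lead_coeffs m.lead_coeffs]

  obtain d where d: "?P * ?Rh n = (\<Sum>m=n..n + K. Polynomial.smult (d m) (?R m))"
  proof -
    have "toeplitz_form w (?P * ?Rh n) (pCons 0 r) = 0" if "degree r < n" for r
      unfolding toeplitz_form_modified[symmetric] using that by (rule m.reciprocal_orthogonal)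
    then show thesis
      using that o.reciprocal_span[of n "n + K" "?P * ?Rh n"] deg_le[of "?Rh n"]
      by (auto simp: m.degree_reciprocal)
  qed
  have indep_star: "\<forall>Q e. degree Q < n \<longrightarrow>
      ?P * Q = (\<Sum>m=n..<n + K. Polynomial.smult (e m) (?R m)) \<longrightarrow> Q = 0"
  proof (intro allI impI)
    fix Q e
    assume Q: "degree Q < n" "?P * Q = (\<Sum>m=n..<n + K. Polynomial.smult (e m) (?R m))"
    have "toeplitz_form ?wh Q (pCons 0 r) = 0" if "degree r < n" for r
      unfolding toeplitz_form_modified Q(2) o.pair.sum_left using that
      by (intro sum.neutral) (auto simp: o.reciprocal_orthogonal)
    then obtain b where "Q = Polynomial.smult b (?Rh n)"
      using m.reciprocal_unique[of Q n] Q(1) by auto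
    \<comment> \<open>A non-zero multiple of the reciprocal has degree n, too large for
      \<open>Q\<close>.\<close>
    then show "Q = 0"
      using Q(1) m.degree_reciprocal[of n] by (cases "b = 0") auto
  qed
  note \<phi>s = linear_form_eq_det_ratio[OF assms(2) o.degree_reciprocal o.reciprocal_nonzero
      m.degree_reciprocal d indep_star,
      unfolded o.lead_coeff_reciprocal m.lead_coeff_reciprocal]

  have 1: "(\<Prod>j=1..K. z - \<alpha> j) * poly (\<Phi> n) z =
        (-1) ^ K * (\<kappa>h n / \<kappa> (n + K)) *
        (det_v n K \<alpha> (v_row n K (polys \<phi>) z) (polys \<phi>) / det_u n K \<alpha> (polys \<phi>))" for z
    using arg_cong[OF c, of "\<lambda>p. poly p z"] \<phi>(2)[where x = "\<lambda>m. poly (\<phi> m) z"] unfolding v_row_def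
    by (simp add: poly_sum poly_node_poly)
  have 2: "(\<Prod>j=1..K. z - \<alpha> j) * poly (?Rh n) z =
        (-1) ^ K * (poly (\<Phi>b n) 0 / poly (\<phi>b (n + K)) 0) *
        (det_v n K \<alpha> (v_row n K (polys ?R) z) (polys ?R) / det_u n K \<alpha> (polys ?R))" for z
    using arg_cong[OF d, of "\<lambda>p. poly p z"] \<phi>s(2)[where x = "\<lambda>m. poly (?R m) z"] unfolding v_row_def
    by (simp add: poly_sum poly_node_poly)
  have 3: "assoc_fun ?wh \<kappa>h \<Phi> n z =
        (-1) ^ K * (\<kappa>h n / \<kappa> (n + K)) *
        (det_v n K \<alpha> (v_row n K (assoc_fun w \<kappa> \<phi>) z) (polys \<phi>) / det_u n K \<alpha> (polys \<phi>))"
    if z: "norm z \<noteq> 1" for z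
    unfolding v_row_def \<phi>(2)[symmetric] m.assoc_fun_eq[OF z] o.assoc_fun_eq[OF z]
    by (intro circle_integral_modified_sum[OF _ _ _ c] o.weight continuous_on_add
        continuous_on_kernel z continuous_on_const) simp
  have 4: "assoc_fun_star ?wh \<kappa>h \<Phi>b n z =
        (-1) ^ K * (poly (\<Phi>b n) 0 / poly (\<phi>b (n + K)) 0) *
        (det_v n K \<alpha> (v_row n K (assoc_fun_star w \<kappa> \<phi>b) z) (polys ?R) / det_u n K \<alpha> (polys ?R))"
    if z: "norm z \<noteq> 1" for z
    unfolding v_row_def \<phi>s(2)[symmetric] m.assoc_fun_star_eq[OF z] o.assoc_fun_star_eq[OF z]
    by (intro circle_integral_modified_sum[OF _ _ _ d] o.weight continuous_on_diff
        continuous_on_kernel z continuous_on_const) simp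

  \<comment> \<open>This sign cancels the one in \<open>1\<close> and \<open>2\<close> at z =
    0.\<close>
  have at_0: "(\<Prod>j=1..K. 0 - \<alpha> j) = (-1) ^ K * (\<Prod>j=1..K. \<alpha> j)"
    using prod.distrib[of "\<lambda>_. -1" \<alpha> "{1..K}"] by simp
  let ?t = "poly (\<Phi>b n) 0 / poly (\<phi>b (n + K)) 0"
  let ?D = "det_v n K \<alpha> (segment n (K + 1) \<kappa>) (polys ?R)"
  let ?E = "det_v n K \<alpha> (segment n (K + 1) (\<lambda>m. 1 / \<kappa> m)) (polys ?R)"
  let ?U = "det_u n K \<alpha> (polys ?R)"
  have D: "(-1) ^ K * (\<Prod>j=1..K. \<alpha> j) * \<kappa>h n = (-1) ^ K * ?t * (?D / ?U)"
    using 2[of 0] unfolding at_0 by (simp add: v_row_def o.poly_reciprocal_0 m.poly_reciprocal_0)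
  \<comment> \<open>The expansion \<open>d\<close> is integrated against the constant 1.\<close>
  have E: "1 / \<kappa>h n = (-1) ^ K * ?t * (?E / ?U)"
  proof -
    have "circle_integral (\<lambda>\<zeta>. ?wh \<zeta> * (poly (?Rh n) \<zeta> * poly 1 (1 / \<zeta>))) =
        (\<Sum>m=n..n + K. d m * circle_integral (\<lambda>\<zeta>. w \<zeta> * (poly (?R m) \<zeta> * poly 1 (1 / \<zeta>))))"
      by (intro circle_integral_modified_sum[OF _ _ _ d] o.weight continuous_on_poly_inverse) simp
    then show ?thesis
      unfolding toeplitz_form_def[symmetric] o.toeplitz_form_reciprocal_1 m.toeplitz_form_reciprocal_1
        \<phi>s(2) .
  qed
  have 5: "(\<Prod>i=1..K. \<alpha> i) * (\<kappa>h n)\<^sup>2 = (-1) ^ K * (?D / ?E) \<and>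
      r_coeff \<kappa>h \<Phi> n = 1 / (\<kappa> (n + K) * (\<Prod>i=1..K. \<alpha> i)) *
          (det_v n K \<alpha> (v_row n K (polys \<phi>) 0) (polys \<phi>) / det_u n K \<alpha> (polys \<phi>)) \<and>
      r_coeff \<kappa>h \<Phi>b n = poly (\<phi>b (n + K)) 0 * (\<Prod>i=1..K. \<alpha> i) * (?U / ?D)"
    if "\<forall>i\<in>{1..K}. \<alpha> i \<noteq> 0"
  proof (intro conjI)
    let ?p = "\<Prod>i=1..K. \<alpha> i"
    have p: "?p \<noteq> 0" using that by simp
    have k: "\<kappa>h n \<noteq> 0" "\<kappa> (n + K) \<noteq> 0"
      by (rule m.kappa_nonzero, rule o.kappa_nonzero)
    have b: "poly (\<phi>b (n + K)) 0 \<noteq> 0"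
      using o.\<phi>b_0_nonzero by (simp add: poly_0_coeff_0)
    have s: "(-1 :: complex) ^ K * (-1) ^ K = 1" by (simp flip: power_mult_distrib)
    have D': "?p * \<kappa>h n = ?t * (?D / ?U)"
    proof -
      have "(-1) ^ K * (?p * \<kappa>h n) = (-1) ^ K * (?t * (?D / ?U))"
        using D by (simp only: mult.assoc)
      then show ?thesis unfolding mult_cancel_left by simp
    qed
    \<comment> \<open>The left sides of \<open>D'\<close> and \<open>E\<close> are non-zero. A zero
      denominator would make the right side 0 as well, because x / 0 = 0.\<close>
    have nz: "?t \<noteq> 0" "?U \<noteq> 0" "?D \<noteq> 0" "?E \<noteq> 0"
      using D' E p k by auto
    \<comment> \<open>Dividing \<open>D'\<close> by \<open>E\<close> eliminates \<open>?t\<close>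
      and \<open>?U\<close>.\<close>
    have "?p * (\<kappa>h n)\<^sup>2 = (?p * \<kappa>h n) / (1 / \<kappa>h n)"
      by (simp add: power2_eq_square)
    also have "\<dots> = (-1) ^ K * (?D / ?E)"
      unfolding D' E using nz s by (simp add: field_simps)
    finally show "?p * (\<kappa>h n)\<^sup>2 = (-1) ^ K * (?D / ?E)" .
    have "?p * poly (\<Phi> n) 0 = \<kappa>h n / \<kappa> (n + K) *
        (det_v n K \<alpha> (v_row n K (polys \<phi>) 0) (polys \<phi>) / det_u n K \<alpha> (polys \<phi>))"
    proof -
      have "(-1) ^ K * (?p * poly (\<Phi> n) 0) = (-1) ^ K * (\<kappa>h n / \<kappa> (n + K) *
          (det_v n K \<alpha> (v_row n K (polys \<phi>) 0) (polys \<phi>) / det_u n K \<alpha> (polys \<phi>)))"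
        using 1[of 0] unfolding at_0 by (simp only: mult.assoc)
      then show ?thesis unfolding mult_cancel_left by simp
    qed
    then show "r_coeff \<kappa>h \<Phi> n = 1 / (\<kappa> (n + K) * ?p) *
        (det_v n K \<alpha> (v_row n K (polys \<phi>) 0) (polys \<phi>) / det_u n K \<alpha> (polys \<phi>))"
      using p k \<phi>(1) by (simp add: r_coeff_def field_simps)
    \<comment> \<open>\<open>D'\<close> is solved for the value of \<open>\<Phi>b n\<close> at 0,
      which is the numerator of \<open>?t\<close>.\<close>
    show "r_coeff \<kappa>h \<Phi>b n = poly (\<phi>b (n + K)) 0 * ?p * (?U / ?D)"
      using D' nz k b p by (simp add: r_coeff_def field_simps)
  qed
  show ?thesis
    using 1 2 3 4 5 by blast
qed

end
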